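(* In a proper bracket, if in a given round $m$ teams have a bye and $k$ games are being played, then if the bracket goes chalk, the matchups in that round will be seed $m+i$ versus seed $(m+2k+1)-i$ for $i\in\{1,\dots,k\}$.
   Context: A bracket on $n\ge1$ teams is a full binary tree (children unordered) whose $n$ leaves are labelled bijectively by the seeds $1,\dots,n$. Team $t_i$ (the $i$-seed) begins at the leaf labelled $i$. Each internal node is a game between the teams arriving from its two children; the winner moves up and the loser plays no more games (is eliminated); the team reaching the root is the champion. If the tree has height $r$, there are $r$ rounds: the games at distance $d$ from the root form round $r-d$. A team has a bye in round $s$ if it plays no game in round $s$ or before. Smaller numbers are higher seeds. A bracket goes chalk if the higher-seeded team (smaller number) wins every game. A bracket is proper if, when it goes chalk, in every round it is better to be a higher-seeded than a lower-seeded team, where (a) it is better to have a bye than to play a game, and (b) it is better to play a lower seed than a higher seed. Explicitly: for every round $s$ and all $i<j$ such that $t_i$ and $t_j$ have not lost before round $s$ when the bracket goes chalk: if $t_j$ has a bye in round $s$ then so does $t_i$; and if both play in round $s$, then the opponent of $t_i$ has a larger seed number than the opponent of $t_j$. *)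

theory Defs
  imports Main
begin

text \<open>A full binary tree whose leaves carry seeds. The constructor \<open>Game\<close> records its two
  children in some order, but every notion below is invariant under swapping children
  (matchups are unordered pairs), so quantifying over these trees amounts to quantifying over
  trees with unordered children.\<close>

datatype bracket = Team nat | Game bracket bracket

fun seeds :: "bracket \<Rightarrow> nat list" where
  "seeds (Team i) = [i]"
| "seeds (Game l r) = seeds l @ seeds r"

definition is_bracket :: "nat \<Rightarrow> bracket \<Rightarrow> bool" where
  "is_bracket n B \<longleftrightarrow> 1 \<le> n \<and> distinct (seeds B) \<and> set (seeds B) = {1..n}"

fun height :: "bracket \<Rightarrow> nat" where
  "height (Team i) = 0"
| "height (Game l r) = Suc (max (height l) (height r))"

text \<open>The subtrees rooted at distance \<open>d\<close> from the root. As the seeds of a bracket are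
  distinct, different nodes have different subtrees, so a set loses nothing.\<close>

fun subtrees_at :: "nat \<Rightarrow> bracket \<Rightarrow> bracket set" where
  "subtrees_at 0 B = {B}"
| "subtrees_at (Suc d) (Team i) = {}"
| "subtrees_at (Suc d) (Game l r) = subtrees_at d l \<union> subtrees_at d r"

text \<open>A game is identified with the subtree rooted at its internal node. The rounds are
  \<open>1, \<dots>, height B\<close>; the guard is needed because natural subtraction truncates.\<close>

definition games :: "bracket \<Rightarrow> nat \<Rightarrow> bracket set" where
  "games B s = {G. s \<in> {1..height B} \<and> G \<in> subtrees_at (height B - s) B \<and> (\<exists>l r. G = Game l r)}"

text \<open>The seed of the team that reaches the root when the smaller seed wins every game.\<close>

fun chalk_champion :: "bracket \<Rightarrow> nat" where
  "chalk_champion (Team i) = i"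
| "chalk_champion (Game l r) = min (chalk_champion l) (chalk_champion r)"

text \<open>All notions below refer to the bracket going chalk.\<close>

definition matchups :: "bracket \<Rightarrow> nat \<Rightarrow> nat set set" where
  "matchups B s = {{chalk_champion l, chalk_champion r} | l r. Game l r \<in> games B s}"

definition opponent :: "bracket \<Rightarrow> nat \<Rightarrow> nat \<Rightarrow> nat \<Rightarrow> bool" where
  "opponent B s i a \<longleftrightarrow> {i, a} \<in> matchups B s"

definition plays :: "bracket \<Rightarrow> nat \<Rightarrow> nat \<Rightarrow> bool" where
  "plays B s i \<longleftrightarrow> (\<exists>a. opponent B s i a)"

text \<open>Every team plays the game at the parent of its leaf whatever the results are, so
  having a bye does not depend on the bracket going chalk.\<close>

definition has_bye :: "bracket \<Rightarrow> nat \<Rightarrow> nat \<Rightarrow> bool" where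
  "has_bye B s i \<longleftrightarrow> i \<in> set (seeds B) \<and> (\<forall>u\<le>s. \<not> plays B u i)"

definition lost_before :: "bracket \<Rightarrow> nat \<Rightarrow> nat \<Rightarrow> bool" where
  "lost_before B s i \<longleftrightarrow> (\<exists>u<s. \<exists>a. opponent B u i a \<and> a < i)"

definition proper :: "bracket \<Rightarrow> bool" where
  "proper B \<longleftrightarrow>
    (\<forall>s\<in>{1..height B}. \<forall>i\<in>set (seeds B). \<forall>j\<in>set (seeds B).
       i < j \<and> \<not> lost_before B s i \<and> \<not> lost_before B s j \<longrightarrow>
         (has_bye B s j \<longrightarrow> has_bye B s i) \<and>
         (\<forall>a b. opponent B s i a \<and> opponent B s j b \<longrightarrow> b < a))"

end

theory Submission
  imports Defs
begin

text \<open>When a proper bracket goes chalk, the teams still alive before any given round are the top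
  seeds: were a loser of round \<open>s\<close> seeded above a survivor of round \<open>s\<close>, the survivor would have
  played in that round too (byes go to the top seeds), against an even higher seed, and lost.
  Hence the players of a round form an interval of seeds starting at \<open>m + 1\<close>.
  Properness makes the opponent map strictly decreasing on this interval, so it must be the
  reversal of the interval, which has even length as no team plays itself.\<close>

section \<open>Subtrees of a bracket and their champions\<close>

lemma chalk_champion_eq_Min: "chalk_champion T = Min (set (seeds T))"
proof (induction T)
  case (Game l r)
  have "seeds T \<noteq> []" for T by (induction T) auto
  with Game show ?case by (simp add: Min_Un)
qed simp

lemma chalk_champion_in_seeds: "chalk_champion T \<in> set (seeds T)"
  by (induction T) (auto simp: min_def)

lemma chalk_champion_le: "i \<in> set (seeds T) \<Longrightarrow> chalk_champion T \<le> i"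
  by (simp add: chalk_champion_eq_Min)

lemma seeds_subtrees_at: "T \<in> subtrees_at d B \<Longrightarrow> set (seeds T) \<subseteq> set (seeds B)"
  by (induction d B rule: subtrees_at.induct) auto

lemma distinct_seeds_subtrees_at:
  "T \<in> subtrees_at d B \<Longrightarrow> distinct (seeds B) \<Longrightarrow> distinct (seeds T)"
  by (induction d B rule: subtrees_at.induct) auto

text \<open>With distinct seeds the children of a game share no leaf, so subtrees at equal depth
  have disjoint leaf sets and any one seed singles out its subtree.\<close>

lemma subtrees_at_eqI:
  assumes "distinct (seeds B)" "T \<in> subtrees_at d B" "T' \<in> subtrees_at d B"
    and "x \<in> set (seeds T)" "x \<in> set (seeds T')"
  shows "T = T'"
  using assms
proof (induction d B rule: subtrees_at.induct)
  case (3 d l r)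
  then show ?case using seeds_subtrees_at[of _ d l] seeds_subtrees_at[of _ d r] by fastforce
qed auto

text \<open>Used with \<open>e = 1\<close> to pass between a game and its children, and with general
  \<open>e\<close> to place a game of an early round inside a subtree of a later one.\<close>

lemma subtrees_at_add: "subtrees_at (d + e) B = (\<Union>C\<in>subtrees_at d B. subtrees_at e C)"
  by (induction d B rule: subtrees_at.induct) auto

lemma subtrees_at_SucE:
  assumes "T \<in> subtrees_at (Suc d) B"
  obtains l r where "Game l r \<in> subtrees_at d B" "T = l \<or> T = r"
proof -
  from assms obtain C where "C \<in> subtrees_at d B" "T \<in> subtrees_at (Suc 0) C"
    using subtrees_at_add[of d "Suc 0" B] by auto
  then show thesis using that by (cases C) auto
qed

lemma subtrees_at_child:
  assumes "Game l r \<in> subtrees_at d B"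
  shows "l \<in> subtrees_at (Suc d) B" "r \<in> subtrees_at (Suc d) B"
  using assms subtrees_at_add[of d "Suc 0" B] by force+

section \<open>Opponents, and the progress of a team through the rounds\<close>

lemma opponent_iff:
  "opponent B s i a \<longleftrightarrow> s \<in> {1..height B} \<and>
     (\<exists>l r. Game l r \<in> subtrees_at (height B - s) B \<and> {i, a} = {chalk_champion l, chalk_champion r})"
  unfolding opponent_def matchups_def games_def by auto

lemma opponent_sym: "opponent B s i a \<longleftrightarrow> opponent B s a i"
  by (simp add: opponent_def insert_commute)

lemma opponent_in_seeds:
  assumes "opponent B s i a"
  shows "i \<in> set (seeds B)"
proof -
  from assms obtain l r where G: "Game l r \<in> subtrees_at (height B - s) B"
    and ia: "{i, a} = {chalk_champion l, chalk_champion r}"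
    unfolding opponent_iff by blast
  from ia have "i \<in> set (seeds (Game l r))"
    using chalk_champion_in_seeds[of l] chalk_champion_in_seeds[of r] by (auto simp: doubleton_eq_iff)
  with seeds_subtrees_at[OF G] show ?thesis by blast
qed

lemma Game_champions_neq:
  assumes "distinct (seeds B)" "Game l r \<in> subtrees_at d B"
  shows "chalk_champion l \<noteq> chalk_champion r"
  using distinct_seeds_subtrees_at[OF assms(2,1)]
    chalk_champion_in_seeds[of l] chalk_champion_in_seeds[of r] by auto

lemma opponent_neq:
  assumes "distinct (seeds B)" "opponent B s i a"
  shows "i \<noteq> a"
proof -
  from assms(2) obtain l r where G: "Game l r \<in> subtrees_at (height B - s) B"
    and ia: "{i, a} = {chalk_champion l, chalk_champion r}"
    unfolding opponent_iff by blast
  from Game_champions_neq[OF assms(1) G] ia show ?thesis by (auto simp: doubleton_eq_iff)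
qed

text \<open>A team playing a game is a leaf below it, and leaf sets at one depth are disjoint. Hence
  a team plays at most one game per round.\<close>

lemma Game_eqI:
  assumes "distinct (seeds B)" "Game l r \<in> subtrees_at d B" "Game l' r' \<in> subtrees_at d B"
    and "i \<in> {chalk_champion l, chalk_champion r}" "i \<in> {chalk_champion l', chalk_champion r'}"
  shows "Game l r = Game l' r'"
proof (rule subtrees_at_eqI[OF assms(1-3)])
  show "i \<in> set (seeds (Game l r))" "i \<in> set (seeds (Game l' r'))"
    using assms(4,5) chalk_champion_in_seeds by auto
qed

lemma opponent_unique:
  assumes "distinct (seeds B)" "opponent B s i a" "opponent B s i b"
  shows "a = b"
proof -
  from assms(2,3) obtain l r l' r' where
    G: "Game l r \<in> subtrees_at (height B - s) B" "{i, a} = {chalk_champion l, chalk_champion r}"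
    and G': "Game l' r' \<in> subtrees_at (height B - s) B" "{i, b} = {chalk_champion l', chalk_champion r'}"
    unfolding opponent_iff by metis
  have "Game l r = Game l' r'"
    using Game_eqI[OF assms(1) G(1) G'(1), of i] G(2) G'(2) by blast
  with G(2) G'(2) show ?thesis by (auto simp: doubleton_eq_iff)
qed

text \<open>The game won by \<open>i\<close> is not the root, since \<open>s < height B\<close>. Its
  parent is a game of round \<open>Suc s\<close>, and \<open>i\<close> enters it as the champion of
  one child.\<close>

lemma winner_plays_next:
  assumes "opponent B s i a" "i < a" "s < height B"
  shows "plays B (Suc s) i"
proof -
  from assms(1) obtain l r where s: "1 \<le> s"
    and G: "Game l r \<in> subtrees_at (height B - s) B" "{i, a} = {chalk_champion l, chalk_champion r}"
    unfolding opponent_iff by auto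
  define d where "d = height B - Suc s"
  have "Game l r \<in> subtrees_at (Suc d) B"
    using G(1) assms(3) by (simp add: d_def Suc_diff_Suc)
  then obtain l' r' where G': "Game l' r' \<in> subtrees_at d B" "Game l r = l' \<or> Game l r = r'"
    by (rule subtrees_at_SucE)
  have "chalk_champion (Game l r) = i"
    using G(2) assms(2) by (auto simp: doubleton_eq_iff)
  with G'(2) have "\<exists>b. {i, b} = {chalk_champion l', chalk_champion r'}"
    by (metis insert_commute)
  with G'(1) s assms(3) show ?thesis
    unfolding plays_def opponent_iff d_def by fastforce
qed

text \<open>Suppose \<open>i\<close> had lost earlier to \<open>a\<close>. The lost game lies in the
  child from which \<open>i\<close> enters its game of round \<open>s\<close>, so \<open>i\<close>
  would be the champion of a subtree that contains the smaller seed \<open>a\<close>.\<close>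

lemma plays_not_lost_before:
  assumes "distinct (seeds B)" "plays B s i"
  shows "\<not> lost_before B s i"
proof
  assume "lost_before B s i"
  then obtain u a l r where u: "u < s" "a < i"
    and G: "Game l r \<in> subtrees_at (height B - u) B" "{i, a} = {chalk_champion l, chalk_champion r}"
    unfolding lost_before_def opponent_iff by blast
  from assms(2) obtain b l' r' where s: "s \<in> {1..height B}"
    and G': "Game l' r' \<in> subtrees_at (height B - s) B" "{i, b} = {chalk_champion l', chalk_champion r'}"
    unfolding plays_def opponent_iff by blast
  define d where "d = height B - s"
  from G'(2) obtain C where C: "C \<in> {l', r'}" "i = chalk_champion C"
    by (auto simp: doubleton_eq_iff)
  have C_at: "C \<in> subtrees_at (Suc d) B"
    using subtrees_at_child[OF G'(1)] C(1) by (auto simp: d_def)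
  \<comment> \<open>Children of round \<open>s\<close> games sit at depth \<open>Suc d\<close>; the
    game of round \<open>u\<close> is \<open>s - u - 1\<close> levels further down, inside some
    subtree \<open>C'\<close> at that depth.\<close>
  have "height B - u = Suc d + (s - u - 1)"
    using u(1) s by (auto simp: d_def)
  with G(1) obtain C' where C': "C' \<in> subtrees_at (Suc d) B" "Game l r \<in> subtrees_at (s - u - 1) C'"
    using subtrees_at_add by (metis UN_E)
  have "{i, a} \<subseteq> set (seeds (Game l r))"
    using G(2) chalk_champion_in_seeds by auto
  with seeds_subtrees_at[OF C'(2)] have ia: "i \<in> set (seeds C')" "a \<in> set (seeds C')"
    by auto
  have "C = C'"
    using subtrees_at_eqI[OF assms(1) C_at C'(1), of i] ia(1) C(2) chalk_champion_in_seeds by auto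
  with ia(2) C(2) chalk_champion_le[of a C'] u(2) show False by simp
qed

text \<open>Without a bye, \<open>i\<close> played in some round \<open>u \<le> s\<close>. It has
  won every game before round \<open>s\<close>, and each win leads to a game in the next
  round.\<close>

lemma plays_if_not_bye:
  assumes "distinct (seeds B)" "s \<le> height B" "i \<in> set (seeds B)"
    and "\<not> lost_before B s i" "\<not> has_bye B s i"
  shows "plays B s i"
proof -
  from assms(3,5) obtain u where u: "u \<le> s" "plays B u i"
    unfolding has_bye_def by blast
  from u(1) show ?thesis
  proof (induction s rule: dec_induct)
    case (step v)
    then obtain a where a: "opponent B v i a" unfolding plays_def by blast
    with assms(4) step.hyps(2) have "\<not> a < i" unfolding lost_before_def by blast
    with opponent_neq[OF assms(1) a] have "i < a" by simp
    with winner_plays_next[OF a] step.hyps(2) assms(2) show ?case by simp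
  qed (rule u(2))
qed

section \<open>Properness and the order of elimination\<close>

lemma properD:
  assumes "proper B" "s \<in> {1..height B}" "i \<in> set (seeds B)" "j \<in> set (seeds B)"
    and "i < j" "\<not> lost_before B s i" "\<not> lost_before B s j"
  shows "has_bye B s j \<Longrightarrow> has_bye B s i"
    and "opponent B s i a \<Longrightarrow> opponent B s j b \<Longrightarrow> b < a"
  using assms unfolding proper_def by blast+

lemma lost_before_mono:
  assumes "distinct (seeds B)" "proper B" "s \<le> height B"
    and "i \<in> set (seeds B)" "j \<in> set (seeds B)" "i < j"
  shows "lost_before B s i \<Longrightarrow> lost_before B s j"
  using assms(3)
proof (induction s)
  case 0
  then show ?case by (simp add: lost_before_def)
next
  case (Suc s)
  have lost_Suc: "lost_before B (Suc s) x \<longleftrightarrow> lost_before B s x \<or> (\<exists>a. opponent B s x a \<and> a < x)" for x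
    unfolding lost_before_def less_Suc_eq by blast
  show ?case
  proof (cases "lost_before B s i \<or> lost_before B s j")
    case True
    with Suc.IH Suc.prems(2) lost_Suc show ?thesis by auto
  next
    case False
    with Suc.prems(1) lost_Suc obtain a where a: "opponent B s i a" "a < i" by blast
    then have s: "s \<in> {1..height B}" unfolding opponent_iff by blast
    note better = properD[OF assms(2) s assms(4,5,6)]
    from a(1) have "\<not> has_bye B s i" unfolding has_bye_def plays_def by blast
    with better(1) False have "\<not> has_bye B s j" by blast
    with plays_if_not_bye[OF assms(1) _ assms(5)] False s obtain b where b: "opponent B s j b"
      unfolding plays_def by auto
    with better(2) False a(1) have "b < a" by blast
    \<comment> \<open>The chain \<open>b < a < i < j\<close> makes \<open>j\<close> lose its game of
      round \<open>s\<close>.\<close>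
    with a(2) assms(6) b lost_Suc show ?thesis by (metis less_trans)
  qed
qed

section \<open>Initial segments, reflections and counting\<close>

lemma down_closed_eq_atLeastAtMost:
  fixes A :: "nat set"
  assumes "A \<subseteq> {1..n}" and "\<And>i j. j \<in> A \<Longrightarrow> 1 \<le> i \<Longrightarrow> i < j \<Longrightarrow> i \<in> A"
  shows "A = {1..card A}"
proof (cases "A = {}")
  case False
  have "finite A" using assms(1) finite_subset by blast
  with False have Max: "Max A \<in> A" "\<And>i. i \<in> A \<Longrightarrow> i \<le> Max A" by simp_all
  have "A = {1..Max A}"
  proof
    show "A \<subseteq> {1..Max A}" using assms(1) Max(2) by auto
    show "{1..Max A} \<subseteq> A" using assms(2)[OF Max(1)] Max(1) by (auto simp: le_less)
  qed
  then show ?thesis by (metis card_atLeastAtMost diff_Suc_1)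
qed simp

text \<open>From \<open>f a \<le> b\<close>, each unit step to the right lowers \<open>f\<close> by
  at least one; from \<open>a \<le> f b\<close>, each step to the left raises it by at least one. At
  \<open>x\<close> the two bounds coincide.\<close>

lemma strict_antimono_eq_reflection:
  fixes f :: "nat \<Rightarrow> nat"
  assumes maps: "\<And>x. x \<in> {a..b} \<Longrightarrow> f x \<in> {a..b}"
    and anti: "\<And>x y. x \<in> {a..b} \<Longrightarrow> y \<in> {a..b} \<Longrightarrow> x < y \<Longrightarrow> f y < f x"
    and x: "x \<in> {a..b}"
  shows "f x = a + b - x"
proof -
  have upper: "f (a + e) + e \<le> b" if "a + e \<le> b" for e
    using that
  proof (induction e)
    case 0
    then show ?case using maps[of a] by simp
  next
    case (Suc e)
    then show ?case using anti[of "a + e" "a + Suc e"] by simp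
  qed
  have lower: "a + e \<le> f (b - e)" if "a + e \<le> b" for e
    using that
  proof (induction e)
    case 0
    then show ?case using maps[of b] by simp
  next
    case (Suc e)
    then have "a \<le> b - Suc e" "b - Suc e < b - e" by linarith+
    with Suc anti[of "b - Suc e" "b - e"] show ?case by simp
  qed
  have "a \<le> x" "x \<le> b" using x by simp_all
  then have "f x + (x - a) \<le> b" "a + (b - x) \<le> f x"
    using upper[of "x - a"] lower[of "b - x"] by simp_all
  with \<open>a \<le> x\<close> \<open>x \<le> b\<close> show ?thesis by linarith
qed

text \<open>Matchups form a set of pairs, so different games might collapse to one pair; this is
  excluded because a shared champion forces the games to be equal.\<close>

lemma card_games_eq_card_matchups:
  assumes "distinct (seeds B)"
  shows "card (games B s) = card (matchups B s)"
proof -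
  \<comment> \<open>The value at \<open>Team\<close> is a dummy, as all games are internal
    nodes.\<close>
  define f where "f G = (case G of Team i \<Rightarrow> {} | Game l r \<Rightarrow> {chalk_champion l, chalk_champion r})" for G
  have "inj_on f (games B s)"
  proof (rule inj_onI)
    fix G G' assume *: "G \<in> games B s" "G' \<in> games B s" "f G = f G'"
    then obtain l r l' r' where G: "G = Game l r" "G' = Game l' r'"
      unfolding games_def by blast
    with * show "G = G'"
      using Game_eqI[OF assms, of l r "height B - s" l' r' "chalk_champion l"]
      unfolding games_def f_def by auto
  qed
  moreover have "f ` games B s = matchups B s"
  proof
    show "f ` games B s \<subseteq> matchups B s"
      unfolding matchups_def f_def by (auto simp: games_def) blast
    show "matchups B s \<subseteq> f ` games B s"
      unfolding matchups_def f_def by force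
  qed
  ultimately show ?thesis by (metis card_image)
qed

text \<open>A reflection without fixed points splits the interval into pairs, each named by its
  smaller element \<open>m + i\<close> in the lower half. The cardinality serves to identify
  \<open>k\<close> with the number of games.\<close>

lemma reflection_pairs:
  fixes m N :: nat
  assumes "\<And>x. x \<in> {Suc m..N} \<Longrightarrow> Suc m + N - x \<noteq> x" and "m \<le> N"
  obtains k where "N = m + 2 * k"
    "(\<lambda>x. {x, Suc m + N - x}) ` {Suc m..N} = {{m + i, (m + 2 * k + 1) - i} | i. i \<in> {1..k}}"
    "card {{m + i, (m + 2 * k + 1) - i} | i. i \<in> {1..k}} = k"
proof -
  have "even (N - m)"
  proof (rule ccontr)
    assume "odd (N - m)"
    then obtain q where "N - m = 2 * q + 1" by (rule oddE)
    then have "N = m + 2 * q + 1" using assms(2) by simp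
    \<comment> \<open>The midpoint of an interval of odd length is fixed by the reflection.\<close>
    then show False using assms(1)[of "m + q + 1"] by simp
  qed
  then obtain k where "N - m = 2 * k" by (rule evenE)
  then have N: "N = m + 2 * k" using assms(2) by simp
  define p where "p i = {m + i, (m + 2 * k + 1) - i}" for i
  have P: "{{m + i, (m + 2 * k + 1) - i} | i. i \<in> {1..k}} = p ` {1..k}"
    unfolding p_def by auto
  have "(\<lambda>x. {x, Suc m + N - x}) ` {Suc m..N} = p ` {1..k}"
  proof
    show "(\<lambda>x. {x, Suc m + N - x}) ` {Suc m..N} \<subseteq> p ` {1..k}"
    proof
      fix S assume "S \<in> (\<lambda>x. {x, Suc m + N - x}) ` {Suc m..N}"
      then obtain x where x: "x \<in> {Suc m..N}" "S = {x, Suc m + N - x}" by blast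
      show "S \<in> p ` {1..k}"
      proof (cases "x \<le> m + k")
        case True
        then have "S = p (x - m)" "x - m \<in> {1..k}"
          using x N by (auto simp: p_def)
        then show ?thesis by blast
      next
        case False
        \<comment> \<open>For \<open>x\<close> in the upper half the index comes from its mirror
          image.\<close>
        then have "S = p (m + 2 * k + 1 - x)" "m + 2 * k + 1 - x \<in> {1..k}"
          using x N by (auto simp: p_def doubleton_eq_iff)
        then show ?thesis by blast
      qed
    qed
    show "p ` {1..k} \<subseteq> (\<lambda>x. {x, Suc m + N - x}) ` {Suc m..N}"
    proof
      fix S assume "S \<in> p ` {1..k}"
      then obtain i where i: "i \<in> {1..k}" "S = p i" by blast
      then have "S = {m + i, Suc m + N - (m + i)}" "m + i \<in> {Suc m..N}"
        using N by (auto simp: p_def)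
      then show "S \<in> (\<lambda>x. {x, Suc m + N - x}) ` {Suc m..N}" by blast
    qed
  qed
  moreover have "inj_on p {1..k}"
    by (rule inj_onI) (auto simp: p_def doubleton_eq_iff)
  ultimately show thesis
    using that[OF N] unfolding P by (simp add: card_image)
qed

section \<open>The matchups of a round in a proper bracket\<close>

theorem lemma2p2p12:
  fixes B :: bracket and n s m k :: nat
  assumes "is_bracket n B"
    and "proper B"
    and "s \<in> {1..height B}"
    and "m = card {i. has_bye B s i}"
    and "k = card (games B s)"
  shows "matchups B s = {{m + i, (m + 2 * k + 1) - i} | i. i \<in> {1..k}}"
proof -
  have dist: "distinct (seeds B)" and seeds: "set (seeds B) = {1..n}"
    using assms(1) unfolding is_bracket_def by auto
  define alive where "alive = {i \<in> set (seeds B). \<not> lost_before B s i}"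
  define N where "N = card alive"
  have alive: "alive = {1..N}"
    unfolding N_def
  proof (rule down_closed_eq_atLeastAtMost)
    show "alive \<subseteq> {1..n}" unfolding alive_def seeds by blast
    show "i \<in> alive" if "j \<in> alive" "1 \<le> i" "i < j" for i j
      using that lost_before_mono[OF dist assms(2), of s i j] assms(3)
      unfolding alive_def seeds by auto
  qed
  \<comment> \<open>An earlier loss would be a game played in a round before \<open>s\<close>,
    contrary to the bye.\<close>
  have bye_alive: "i \<in> alive" if "has_bye B s i" for i
    using that unfolding alive_def has_bye_def lost_before_def plays_def
    by (auto dest: less_imp_le)
  have byes: "{i. has_bye B s i} = {1..m}"
    unfolding assms(4)
  proof (rule down_closed_eq_atLeastAtMost)
    show "{i. has_bye B s i} \<subseteq> {1..N}" using bye_alive alive by blast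
    show "i \<in> {i. has_bye B s i}" if "j \<in> {i. has_bye B s i}" "1 \<le> i" "i < j" for i j
    proof -
      have "j \<in> alive" using that bye_alive by blast
      \<comment> \<open>Properness compares only surviving teams, so the shape of
        \<open>alive\<close> has to be known before byes can be passed on to higher seeds.\<close>
      moreover from this have "i \<in> alive" using that alive by auto
      ultimately show ?thesis
        using that properD(1)[OF assms(2,3)] unfolding alive_def by blast
    qed
  qed
  have "m \<le> N"
    using bye_alive byes alive by (cases "m = 0") (auto simp: set_eq_iff)
  have plays_iff: "plays B s i \<longleftrightarrow> i \<in> {Suc m..N}" for i
  proof -
    have "plays B s i \<longleftrightarrow> i \<in> alive \<and> \<not> has_bye B s i"
    proof
      assume i: "plays B s i"
      then have "i \<in> set (seeds B)" unfolding plays_def using opponent_in_seeds by blast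
      with i show "i \<in> alive \<and> \<not> has_bye B s i"
        using plays_not_lost_before[OF dist i] unfolding alive_def has_bye_def by blast
    next
      assume "i \<in> alive \<and> \<not> has_bye B s i"
      then show "plays B s i"
        using plays_if_not_bye[OF dist] assms(3) unfolding alive_def by simp
    qed
    also have "\<dots> \<longleftrightarrow> i \<in> {1..N} \<and> i \<notin> {1..m}"
      unfolding alive byes[symmetric] by simp
    also have "\<dots> \<longleftrightarrow> i \<in> {Suc m..N}"
      by auto
    finally show ?thesis .
  qed
  define opp where "opp i = (THE a. opponent B s i a)" for i
  have opp: "opponent B s i a \<longleftrightarrow> i \<in> {Suc m..N} \<and> a = opp i" for i a
  proof -
    have "opponent B s i (opp i)" if "plays B s i"
      using that opponent_unique[OF dist] unfolding opp_def plays_def by (metis theI)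
    then show ?thesis
      using plays_iff opponent_unique[OF dist] unfolding plays_def by blast
  qed
  have opp_eq: "opp x = Suc m + N - x" if "x \<in> {Suc m..N}" for x
  proof (rule strict_antimono_eq_reflection[OF _ _ that])
    \<comment> \<open>By symmetry the opponent of a player is itself a player.\<close>
    show "opp x \<in> {Suc m..N}" if "x \<in> {Suc m..N}" for x
      using that opp opponent_sym by blast
    show "opp y < opp x" if "x \<in> {Suc m..N}" "y \<in> {Suc m..N}" "x < y" for x y
    proof -
      have "x \<in> alive" "y \<in> alive" using that alive by auto
      then show ?thesis
        using that opp properD(2)[OF assms(2,3)] unfolding alive_def by blast
    qed
  qed
  have "matchups B s = (\<lambda>x. {x, opp x}) ` {Suc m..N}"
  proof -
    have "matchups B s = {{x, a} | x a. opponent B s x a}"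
      unfolding opponent_def by (auto simp: matchups_def)
    then show ?thesis unfolding opp by auto
  qed
  also have "\<dots> = (\<lambda>x. {x, Suc m + N - x}) ` {Suc m..N}"
    by (rule image_cong) (simp_all add: opp_eq)
  finally have matchups: "matchups B s = (\<lambda>x. {x, Suc m + N - x}) ` {Suc m..N}" .
  have "Suc m + N - x \<noteq> x" if "x \<in> {Suc m..N}" for x
    using opponent_neq[OF dist, of s x "opp x"] that opp opp_eq[OF that] by simp
  then obtain k' where
    "matchups B s = {{m + i, (m + 2 * k' + 1) - i} | i. i \<in> {1..k'}}"
    "card {{m + i, (m + 2 * k' + 1) - i} | i. i \<in> {1..k'}} = k'"
    unfolding matchups by (rule reflection_pairs[OF _ \<open>m \<le> N\<close>])
  \<comment> \<open>Both numbers count the matchups of the round.\<close>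
  moreover from this have "k' = k"
    unfolding assms(5) card_games_eq_card_matchups[OF dist] by simp
  ultimately show ?thesis by simp
qed

end
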